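(* Let $q>1$, let $\phi(z)=\sum_{n\geq1}\phi_nz^n$ with real coefficients, $f(z)=z(1-\phi(z))=\sum_{n\ge1}f_nz^n$, and let $g(z)=\sum_{n\geq0}g_nz^n$ be the formal power series with $g_0=0$ solving $\sum_{n\geq 1} f_n\, g(z)g(z/q)\cdots g(z/q^{n-1})=z$. Assume $\sum_{n\geq1}\phi_nz^nq^{-\binom{n-1}2}<\infty$ for every $z>0$. Then $g$ has a positive radius of convergence $\eta$, which satisfies $$\sum_{k\geq1}\phi_k\,g\Bigl(\frac\eta q\Bigr)\cdots g\Bigl(\frac{\eta}{q^k}\Bigr)=1.$$ Furthermore, defining $C$ by $$\frac1C=\sum_{k\geq1}\phi_k\,g\Bigl(\frac\eta q\Bigr)\cdots g\Bigl(\frac\eta{q^k}\Bigr)\sum_{1\leq i\leq k}\frac1{q^i}\frac{g'}{g}\Bigl(\frac\eta{q^i}\Bigr),$$ one has $g_n\sim C/\eta^n$ as $n\to\infty$.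
   Formalization: Beyond positivity of the radius, φ is assumed nonzero with all φ_n ≥ 0, and g_n ~ C/η^n also assumes gcd{n: φ_n≠0}=1; as stated the claims fail for φ=0 (radius infinite), φ=-z (sum equation impossible) and φ=z² (g odd). *)

theory Defs
  imports "HOL-Analysis.Analysis" "HOL-Library.Landau_Symbols"
begin

text \<open>
  The formal power series \<open>g(z/q\<^sup>i)\<close> and the products of its dilates.  Note that
  \<open>fps_qprod q g n\<close> is \<open>g(z) g(z/q) \<dots> g(z/q\<^sup>n\<^sup>-\<^sup>1)\<close>, a formal object, whereas
  \<open>eval_qprod q g x k\<close> is the number \<open>g(x/q) g(x/q\<^sup>2) \<dots> g(x/q\<^sup>k)\<close>, whose dilations
  start at exponent 1.
\<close>

definition fps_qdilate :: "real \<Rightarrow> real fps \<Rightarrow> nat \<Rightarrow> real fps" where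
  "fps_qdilate q g i = fps_compose g (fps_const (1 / q ^ i) * fps_X)"

definition fps_qprod :: "real \<Rightarrow> real fps \<Rightarrow> nat \<Rightarrow> real fps" where
  "fps_qprod q g n = (\<Prod>i<n. fps_qdilate q g i)"

definition eval_qprod :: "real \<Rightarrow> real fps \<Rightarrow> real \<Rightarrow> nat \<Rightarrow> real" where
  "eval_qprod q g x k = (\<Prod>i=1..k. eval_fps g (x / q ^ i))"

definition eval_qlogderiv :: "real \<Rightarrow> real fps \<Rightarrow> real \<Rightarrow> nat \<Rightarrow> real" where
  "eval_qlogderiv q g x k =
     (\<Sum>i=1..k. 1 / q ^ i * (eval_fps (fps_deriv g) (x / q ^ i) / eval_fps g (x / q ^ i)))"

text \<open>
  In a series such as \<open>\<Sum>n\<ge>1. f\<^sub>n \<dots>\<close> we let the index run over all naturals: the constant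
  coefficients of \<open>f\<close> and \<open>\<phi>\<close> are zero, so the term with index 0 vanishes.
  A formal (infinite) sum of power series is \<open>sums\<close> for the metric topology on
  \<open>real fps\<close>, i.e. coefficientwise stabilisation.
\<close>

definition solves_q_equation :: "real \<Rightarrow> real fps \<Rightarrow> real fps \<Rightarrow> bool" where
  "solves_q_equation q f g \<longleftrightarrow>
     fps_nth g 0 = 0 \<and> (\<lambda>n. fps_const (fps_nth f n) * fps_qprod q g n) sums fps_X"

end

theory Submission
  imports Defs "HOL-Complex_Analysis.Cauchy_Integral_Formula"
begin

text \<open>
  Put \<open>U(z) = \<Sum>\<^sub>k \<phi>\<^sub>k g(z/q) \<dots> g(z/q\<^sup>k)\<close>.  The equation says \<open>g (1 - U) = z\<close>.  Because \<open>g\<close> has no constant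
  term, a bound \<open>|g|(r) \<le> A r\<close> on absolute partial sums persists at all smaller radii, so
  \<open>|U|(q r) \<le> \<Sum>\<^sub>k |\<phi>\<^sub>k| (A q r)\<^sup>k q\<^bsup>-k(k+1)/2\<^esup>\<close>, which is finite by the growth assumption.  This gives a
  positive radius of convergence of \<open>g\<close>, and shows that the radius of \<open>U\<close> is at least \<open>q\<close> times as
  large.  For nonnegative \<open>\<phi>\<close> the singularity of \<open>g\<close> at its radius \<open>\<eta>\<close> can then only come from \<open>U(\<eta>) = 1\<close>;
  the two series of the theorem are \<open>U(\<eta>)\<close> and \<open>U'(\<eta>)\<close>, and \<open>g\<^sub>n\<^sub>+\<^sub>1 \<eta>\<^sup>n\<close> is the renewal sequence of the
  probability weights \<open>U\<^sub>n \<eta>\<^sup>n\<close>.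
\<close>

section \<open>Interchange of summation in double series with nonnegative terms\<close>

text \<open>Tonelli's theorem for \<open>sums\<close>: nonnegativity turns each \<open>sums\<close>
  into the unconditional \<open>has_sum\<close>, and the sum over all pairs can then be computed in
  either order.\<close>

lemma sums_swap_nonneg:
  fixes a :: "nat \<Rightarrow> nat \<Rightarrow> real"
  assumes nonneg: "\<And>k n. a k n \<ge> 0"
    and rows: "\<And>k. (\<lambda>n. a k n) sums b k"
    and cols: "\<And>n. (\<lambda>k. a k n) sums u n"
    and total: "u sums s"
  shows "b sums s"
proof -
  have u: "u n \<ge> 0" for n
    using cols[of n] nonneg sums_le[OF _ sums_zero cols[of n]] by simp
  have c: "((\<lambda>k. (\<lambda>(n, k). a k n) (n, k)) has_sum u n) UNIV" for n
    using sums_nonneg_imp_has_sum[OF cols nonneg] by simp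
  have t: "(u has_sum s) UNIV"
    by (rule sums_nonneg_imp_has_sum[OF total u])
  have "(\<lambda>(n, k). a k n) summable_on (UNIV \<times> UNIV)"
    using c t by (intro summable_on_SigmaI[where g = u]) (auto simp: nonneg summable_on_def)
  with c t have "((\<lambda>(n, k). a k n) has_sum s) (UNIV \<times> UNIV)"
    by (intro has_sum_SigmaI[where g = u]) auto
  then have s: "((\<lambda>(k, n). a k n) has_sum s) (UNIV \<times> UNIV)"
    by (subst has_sum_swap) (simp add: case_prod_unfold)
  have "(b has_sum s) UNIV"
    by (rule has_sum_SigmaD[OF s]) (use sums_nonneg_imp_has_sum[OF rows nonneg] in simp)
  then show ?thesis by (rule has_sum_imp_sums)
qed

subsection \<open>Partial sums of absolute values of power series\<close>

text \<open>Truncating at degree \<open>n\<close> keeps the quantity finite before any convergence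
  is known, so that bounds for \<open>g\<close> can be proved by induction on
  \<open>n\<close>.\<close>

definition abs_partial_sum :: "nat \<Rightarrow> real fps \<Rightarrow> real \<Rightarrow> real" where
  "abs_partial_sum n h x = (\<Sum>m\<le>n. \<bar>fps_nth h m\<bar> * x ^ m)"

lemma abs_partial_sum_nonneg: "x \<ge> 0 \<Longrightarrow> abs_partial_sum n h x \<ge> 0"
  unfolding abs_partial_sum_def by (intro sum_nonneg) auto

lemma abs_partial_sum_1 [simp]: "abs_partial_sum n 1 x = 1"
  unfolding abs_partial_sum_def by (simp add: if_distrib[of abs] if_distrib[of "\<lambda>y. y * _"] cong: if_cong)

lemma abs_partial_sum_add:
  assumes "x \<ge> 0"
  shows "abs_partial_sum n (f + g) x \<le> abs_partial_sum n f x + abs_partial_sum n g x"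
  unfolding abs_partial_sum_def sum.distrib[symmetric] distrib_right[symmetric]
  using assms by (intro sum_mono mult_right_mono) auto

text \<open>The left side only sees the triangle \<open>i + j \<le> n\<close>; the right side is the
  sum over the whole square, whose further terms are nonnegative.\<close>

lemma abs_partial_sum_mult:
  assumes "x \<ge> 0"
  shows "abs_partial_sum n (f * g) x \<le> abs_partial_sum n f x * abs_partial_sum n g x"
proof -
  let ?t = "\<lambda>(i, j). (\<bar>fps_nth f i\<bar> * x ^ i) * (\<bar>fps_nth g j\<bar> * x ^ j)"
  have "abs_partial_sum n (f * g) x \<le> (\<Sum>m\<le>n. \<Sum>i\<le>m. ?t (i, m - i))"
    unfolding abs_partial_sum_def
  proof (rule sum_mono)
    fix m
    have "\<bar>fps_nth (f * g) m\<bar> * x ^ m \<le> (\<Sum>i\<le>m. \<bar>fps_nth f i * fps_nth g (m - i)\<bar>) * x ^ m"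
      unfolding fps_mult_nth atLeast0AtMost using assms by (intro mult_right_mono sum_abs) auto
    also have "\<dots> = (\<Sum>i\<le>m. ?t (i, m - i))"
      unfolding sum_distrib_right
    proof (rule sum.cong[OF refl])
      fix i assume "i \<in> {..m}"
      then have "x ^ m = x ^ i * x ^ (m - i)" by (simp flip: power_add)
      then show "\<bar>fps_nth f i * fps_nth g (m - i)\<bar> * x ^ m = ?t (i, m - i)"
        by (simp add: abs_mult)
    qed
    finally show "\<bar>fps_nth (f * g) m\<bar> * x ^ m \<le> (\<Sum>i\<le>m. ?t (i, m - i))" .
  qed
  also have "\<dots> = sum ?t {(i, j). i + j \<le> n}"
    using sum.triangle_reindex_eq[of "\<lambda>i j. ?t (i, j)" n] by simp
  also have "\<dots> \<le> sum ?t ({..n} \<times> {..n})"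
    using assms by (intro sum_mono2) auto
  also have "\<dots> = abs_partial_sum n f x * abs_partial_sum n g x"
    unfolding abs_partial_sum_def sum_product by (simp add: sum.cartesian_product)
  finally show ?thesis .
qed

lemma abs_partial_sum_prod:
  assumes "x \<ge> 0"
  shows "abs_partial_sum n (\<Prod>i\<in>A. F i) x \<le> (\<Prod>i\<in>A. abs_partial_sum n (F i) x)"
proof (induction A rule: infinite_finite_induct)
  case (insert a A)
  have "abs_partial_sum n (F a * (\<Prod>i\<in>A. F i)) x
      \<le> abs_partial_sum n (F a) x * abs_partial_sum n (\<Prod>i\<in>A. F i) x"
    by (rule abs_partial_sum_mult[OF assms])
  also have "\<dots> \<le> abs_partial_sum n (F a) x * (\<Prod>i\<in>A. abs_partial_sum n (F i) x)"
    by (intro mult_left_mono insert.IH abs_partial_sum_nonneg assms)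
  finally show ?case using insert.hyps by simp
qed auto

text \<open>Without a constant term only degrees \<open>m \<ge> 1\<close> occur, and there
  \<open>y ^ m \<le> (y / x) * x ^ m\<close>.\<close>

lemma abs_partial_sum_le_scale:
  assumes "fps_nth g 0 = 0" "0 \<le> y" "y \<le> x" "abs_partial_sum n g x \<le> A * x"
  shows "abs_partial_sum n g y \<le> A * y"
proof (cases "x = 0")
  case True
  with assms show ?thesis by simp
next
  case False
  with assms have x: "x > 0" by simp
  have "abs_partial_sum n g y \<le> y / x * abs_partial_sum n g x"
    unfolding abs_partial_sum_def sum_distrib_left
  proof (rule sum_mono)
    fix m
    show "\<bar>fps_nth g m\<bar> * y ^ m \<le> y / x * (\<bar>fps_nth g m\<bar> * x ^ m)"
    proof (cases m)
      case (Suc k)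
      have "y ^ k \<le> x ^ k" using assms by (intro power_mono) auto
      then have "\<bar>fps_nth g m\<bar> * (y * y ^ k) \<le> \<bar>fps_nth g m\<bar> * (y * x ^ k)"
        using assms by (intro mult_left_mono) auto
      with x Suc show ?thesis by (simp add: field_simps)
    qed (use assms in simp)
  qed
  also have "\<dots> \<le> y / x * (A * x)"
    using assms x by (intro mult_left_mono) auto
  finally show ?thesis using x by (simp add: mult.commute)
qed

lemma fps_conv_radius_geI_abs_partial_sum:
  assumes "x > 0" "\<And>n. abs_partial_sum n h x \<le> B"
  shows "fps_conv_radius h \<ge> ereal x"
proof -
  have "summable (\<lambda>m. \<bar>fps_nth h m * x ^ m\<bar>)"
  proof (rule bounded_imp_summable)
    show "(\<Sum>m\<le>n. \<bar>fps_nth h m * x ^ m\<bar>) \<le> B" for n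
      using assms(2)[of n] assms(1) by (simp add: abs_partial_sum_def abs_mult)
  qed simp
  then have "summable (\<lambda>m. fps_nth h m * x ^ m)"
    by (rule summable_rabs_cancel)
  from conv_radius_geI[OF this] assms(1) show ?thesis
    by (simp add: fps_conv_radius_def)
qed

lemma abs_partial_sum_le_eval_fps:
  assumes "x \<ge> 0" "ereal x < fps_conv_radius h" "\<And>n. fps_nth h n \<ge> 0"
  shows "abs_partial_sum n h x \<le> eval_fps h x"
  unfolding abs_partial_sum_def eval_fps_def
  using assms sum_le_suminf[OF summable_fps[of x h], of "{..n}"] by auto

lemma abs_partial_sum_bounded:
  assumes "x \<ge> 0" "ereal x < fps_conv_radius h"
  obtains B where "B \<ge> 0" "\<And>n. abs_partial_sum n h x \<le> B"
proof
  have s: "summable (\<lambda>m. \<bar>fps_nth h m\<bar> * x ^ m)"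
    using norm_summable_fps[of x h] assms by (simp add: abs_mult)
  show "0 \<le> (\<Sum>m. \<bar>fps_nth h m\<bar> * x ^ m)"
    using s assms by (intro suminf_nonneg) auto
  show "abs_partial_sum n h x \<le> (\<Sum>m. \<bar>fps_nth h m\<bar> * x ^ m)" for n
    unfolding abs_partial_sum_def using assms by (intro sum_le_suminf s) auto
qed

lemma fps_nth_qdilate [simp]: "fps_nth (fps_qdilate q g i) n = fps_nth g n / q ^ (i * n)"
  by (simp add: fps_qdilate_def power_divide power_mult)

lemma abs_partial_sum_qdilate:
  assumes "q > 0"
  shows "abs_partial_sum n (fps_qdilate q g i) x = abs_partial_sum n g (x / q ^ i)"
  unfolding abs_partial_sum_def using assms
  by (intro sum.cong) (auto simp: power_divide power_mult abs_divide abs_mult power_abs)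

subsection \<open>The kernel of the equation\<close>

text \<open>Formal counterpart of \<open>eval_qprod\<close>: what remains of
  \<open>fps_qprod q g (Suc k)\<close> once the undilated factor \<open>g\<close> is split
  off.\<close>

definition fps_shifted_qprod :: "real \<Rightarrow> real fps \<Rightarrow> nat \<Rightarrow> real fps" where
  "fps_shifted_qprod q g k = (\<Prod>i=1..k. fps_qdilate q g i)"

text \<open>The series \<open>U\<close> of the overview. When \<open>g\<close> has no constant term,
  the k-th product starts at degree \<open>k\<close>, so cutting the sum at \<open>k \<le> m\<close>
  loses nothing and avoids an infinite sum of formal series.\<close>

definition q_kernel :: "real \<Rightarrow> real fps \<Rightarrow> real fps \<Rightarrow> real fps" where
  "q_kernel q \<phi> g = Abs_fps (\<lambda>m. \<Sum>k\<le>m. fps_nth \<phi> k * fps_nth (fps_shifted_qprod q g k) m)"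

lemma fps_qprod_Suc_conv_shifted: "fps_qprod q g (Suc n) = g * fps_shifted_qprod q g n"
proof -
  have "fps_qdilate q g 0 = g" by (simp add: fps_eq_iff)
  moreover have "(\<Prod>i<n. fps_qdilate q g (Suc i)) = fps_shifted_qprod q g n"
    unfolding fps_shifted_qprod_def
    by (rule prod.reindex_bij_witness[of _ "\<lambda>i. i - 1" Suc]) auto
  ultimately show ?thesis
    unfolding fps_qprod_def by (simp add: prod.lessThan_Suc_shift del: prod.lessThan_Suc)
qed

text \<open>Each of the \<open>k\<close> factors is divisible by the variable, so the product is
  divisible by its k-th power.\<close>

lemma fps_nth_shifted_qprod_eq_0:
  assumes "fps_nth g 0 = 0" "m < k"
  shows "fps_nth (fps_shifted_qprod q g k) m = 0"
  using assms(2)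
proof (induction k arbitrary: m)
  case (Suc k)
  have "fps_nth (fps_shifted_qprod q g k) i * fps_nth (fps_qdilate q g (Suc k)) (m - i) = 0"
    if "i \<in> {0..m}" for i
  proof (cases "i = m")
    case False
    with that Suc.prems show ?thesis by (simp add: Suc.IH)
  qed (use assms(1) in simp)
  then have "fps_nth (fps_shifted_qprod q g k * fps_qdilate q g (Suc k)) m = 0"
    unfolding fps_mult_nth by (rule sum.neutral[OF ballI])
  then show ?case
    by (simp add: fps_shifted_qprod_def)
qed simp

text \<open>In the lowest degree only the linear coefficients of the factors contribute. This later
  gives \<open>U\<close> a positive coefficient wherever \<open>\<phi>\<close> has one.\<close>

lemma fps_nth_shifted_qprod_diag:
  assumes "fps_nth g 0 = 0"
  shows "fps_nth (fps_shifted_qprod q g k) k = (\<Prod>i=1..k. fps_nth g 1 / q ^ i)"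
proof (induction k)
  case (Suc k)
  have "fps_nth (fps_shifted_qprod q g (Suc k)) (Suc k)
      = (\<Sum>i=0..Suc k. fps_nth (fps_shifted_qprod q g k) i * fps_nth (fps_qdilate q g (Suc k)) (Suc k - i))"
    unfolding fps_shifted_qprod_def by (simp add: fps_mult_nth)
  also have "\<dots> = (\<Sum>i\<in>{k}. fps_nth (fps_shifted_qprod q g k) i * fps_nth (fps_qdilate q g (Suc k)) (Suc k - i))"
  proof (rule sum.mono_neutral_right)
    show "\<forall>i\<in>{0..Suc k} - {k}. fps_nth (fps_shifted_qprod q g k) i * fps_nth (fps_qdilate q g (Suc k)) (Suc k - i) = 0"
    proof
      fix i assume "i \<in> {0..Suc k} - {k}"
      then have "i < k \<or> i = Suc k" by auto
      then show "fps_nth (fps_shifted_qprod q g k) i * fps_nth (fps_qdilate q g (Suc k)) (Suc k - i) = 0"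
        using assms by (auto simp: fps_nth_shifted_qprod_eq_0)
    qed
  qed auto
  finally show ?case by (simp add: Suc.IH)
qed (simp add: fps_shifted_qprod_def)

text \<open>Splitting off \<open>g\<close> from every product and shifting the index by one replaces
  the coefficients of \<open>f\<close> by those of \<open>1 - \<phi>\<close>. In each fixed degree
  only finitely many terms matter.\<close>

lemma solves_q_equation_imp_kernel_equation:
  assumes "fps_nth \<phi> 0 = 0" "solves_q_equation q (fps_X * (1 - \<phi>)) g"
  shows "g * (1 - q_kernel q \<phi> g) = fps_X"
proof (rule fps_ext)
  fix m
  let ?f = "fps_X * (1 - \<phi>)" and ?P = "fps_shifted_qprod q g"
  from assms(2) have g0: "fps_nth g 0 = 0"
    and s: "(\<lambda>n. fps_const (fps_nth ?f n) * fps_qprod q g n) sums fps_X"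
    by (auto simp: solves_q_equation_def)
  \<comment> \<open>Convergence of formal power series means that every coefficient is eventually
    constant.\<close>
  have "eventually (\<lambda>N. fps_nth (\<Sum>n<N. fps_const (fps_nth ?f n) * fps_qprod q g n) m
          = fps_nth fps_X m) sequentially"
    using s unfolding sums_def tendsto_fps_iff by blast
  then obtain N0 where N0: "\<And>N. N \<ge> N0 \<Longrightarrow>
      fps_nth (\<Sum>n<N. fps_const (fps_nth ?f n) * fps_qprod q g n) m = fps_nth fps_X m"
    unfolding eventually_sequentially by blast
  \<comment> \<open>Beyond \<open>N0\<close> the coefficient has stabilised; beyond \<open>m\<close>
    all products that reach degree \<open>m\<close> are included.\<close>
  define N where "N = max N0 (Suc m)"
  have z: "fps_nth (g * ?P k) m = 0" if "m < k" for k
    using fps_nth_shifted_qprod_eq_0[OF g0, of _ k q] that by (simp add: fps_mult_nth)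
  have "fps_nth fps_X m = (\<Sum>n<Suc N. fps_nth ?f n * fps_nth (fps_qprod q g n) m)"
    using N0[of "Suc N"] by (simp add: N_def fps_sum_nth)
  also have "\<dots> = (\<Sum>k<N. fps_nth ?f (Suc k) * fps_nth (fps_qprod q g (Suc k)) m)"
    by (subst sum.lessThan_Suc_shift) simp
  also have "\<dots> = (\<Sum>k<N. (fps_nth 1 k - fps_nth \<phi> k) * fps_nth (g * ?P k) m)"
    by (intro sum.cong refl arg_cong2[where f = "(*)"])
       (simp_all add: fps_qprod_Suc_conv_shifted)
  also have "\<dots> = (\<Sum>k<N. fps_nth 1 k * fps_nth (g * ?P k) m) - (\<Sum>k<N. fps_nth \<phi> k * fps_nth (g * ?P k) m)"
    by (simp add: left_diff_distrib sum_subtractf)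
  also have "(\<Sum>k<N. fps_nth 1 k * fps_nth (g * ?P k) m) = (\<Sum>k\<in>{0}. fps_nth 1 k * fps_nth (g * ?P k) m)"
    by (intro sum.mono_neutral_right) (auto simp: N_def)
  also have "\<dots> = fps_nth g m" by (simp add: fps_shifted_qprod_def)
  also have "(\<Sum>k<N. fps_nth \<phi> k * fps_nth (g * ?P k) m) = (\<Sum>k\<le>m. fps_nth \<phi> k * fps_nth (g * ?P k) m)"
    using z by (intro sum.mono_neutral_right) (auto simp: N_def)
  also have "\<dots> = (\<Sum>i\<le>m. fps_nth g i * (\<Sum>k\<le>m. fps_nth \<phi> k * fps_nth (?P k) (m - i)))"
    unfolding fps_mult_nth atLeast0AtMost sum_distrib_left
    by (subst sum.swap) (simp add: mult_ac)
  also have "\<dots> = (\<Sum>i\<le>m. fps_nth g i * fps_nth (q_kernel q \<phi> g) (m - i))"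
    unfolding q_kernel_def fps_nth_Abs_fps
  proof (rule sum.cong[OF refl])
    fix i assume "i \<in> {..m}"
    have "(\<Sum>k\<le>m. fps_nth \<phi> k * fps_nth (?P k) (m - i)) = (\<Sum>k\<le>m - i. fps_nth \<phi> k * fps_nth (?P k) (m - i))"
      using fps_nth_shifted_qprod_eq_0[OF g0, of "m - i" _ q] by (intro sum.mono_neutral_right) auto
    then show "fps_nth g i * (\<Sum>k\<le>m. fps_nth \<phi> k * fps_nth (?P k) (m - i))
        = fps_nth g i * (\<Sum>k\<le>m - i. fps_nth \<phi> k * fps_nth (?P k) (m - i))"
      by simp
  qed
  also have "\<dots> = fps_nth (g * q_kernel q \<phi> g) m"
    by (simp add: fps_mult_nth atLeast0AtMost)
  finally show "fps_nth (g * (1 - q_kernel q \<phi> g)) m = fps_nth fps_X m"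
    by (simp add: algebra_simps)
qed

section \<open>Majorants for the kernel\<close>

lemma abs_partial_sum_q_kernel:
  assumes "q > 0" "x \<ge> 0"
  shows "abs_partial_sum n (q_kernel q \<phi> g) x
      \<le> (\<Sum>k\<le>n. \<bar>fps_nth \<phi> k\<bar> * (\<Prod>i=1..k. abs_partial_sum n g (x / q ^ i)))"
proof -
  let ?P = "fps_shifted_qprod q g"
  have "abs_partial_sum n (q_kernel q \<phi> g) x
      \<le> (\<Sum>m\<le>n. \<Sum>k\<le>n. \<bar>fps_nth \<phi> k\<bar> * (\<bar>fps_nth (?P k) m\<bar> * x ^ m))"
    unfolding abs_partial_sum_def
  proof (rule sum_mono)
    fix m assume m: "m \<in> {..n}"
    have "\<bar>fps_nth (q_kernel q \<phi> g) m\<bar> \<le> (\<Sum>k\<le>m. \<bar>fps_nth \<phi> k * fps_nth (?P k) m\<bar>)"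
      by (simp add: q_kernel_def)
    also have "\<dots> \<le> (\<Sum>k\<le>n. \<bar>fps_nth \<phi> k * fps_nth (?P k) m\<bar>)"
      using m by (intro sum_mono2) auto
    finally have "\<bar>fps_nth (q_kernel q \<phi> g) m\<bar> * x ^ m \<le> (\<Sum>k\<le>n. \<bar>fps_nth \<phi> k * fps_nth (?P k) m\<bar>) * x ^ m"
      using assms by (intro mult_right_mono) auto
    then show "\<bar>fps_nth (q_kernel q \<phi> g) m\<bar> * x ^ m \<le> (\<Sum>k\<le>n. \<bar>fps_nth \<phi> k\<bar> * (\<bar>fps_nth (?P k) m\<bar> * x ^ m))"
      by (simp add: sum_distrib_right abs_mult mult.assoc)
  qed
  also have "\<dots> = (\<Sum>k\<le>n. \<bar>fps_nth \<phi> k\<bar> * abs_partial_sum n (?P k) x)"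
    unfolding abs_partial_sum_def sum_distrib_left by (rule sum.swap)
  also have "\<dots> \<le> (\<Sum>k\<le>n. \<bar>fps_nth \<phi> k\<bar> * (\<Prod>i=1..k. abs_partial_sum n g (x / q ^ i)))"
    unfolding fps_shifted_qprod_def
    using abs_partial_sum_prod[OF assms(2)] assms(1)
    by (intro sum_mono mult_left_mono) (auto simp flip: abs_partial_sum_qdilate)
  finally show ?thesis .
qed

text \<open>This is where the factor \<open>q\<close> is gained: the kernel evaluates
  \<open>g\<close> only at \<open>z / q ^ i\<close> with \<open>i \<ge> 1\<close>, and these points
  stay below \<open>x\<close> as long as \<open>z \<le> q * x\<close>. The linear bound is carried
  to them by \<open>abs_partial_sum_le_scale\<close>.\<close>

lemma abs_partial_sum_q_kernel_le:
  assumes "q > 1" "fps_nth g 0 = 0" "abs_partial_sum n g x \<le> A * x" "0 \<le> z" "z \<le> q * x"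
  shows "abs_partial_sum n (q_kernel q \<phi> g) z
      \<le> (\<Sum>k\<le>n. \<bar>fps_nth \<phi> k\<bar> * (\<Prod>i=1..k. A * z / q ^ i))"
proof -
  have "abs_partial_sum n (q_kernel q \<phi> g) z
      \<le> (\<Sum>k\<le>n. \<bar>fps_nth \<phi> k\<bar> * (\<Prod>i=1..k. abs_partial_sum n g (z / q ^ i)))"
    using assms by (intro abs_partial_sum_q_kernel) auto
  also have "\<dots> \<le> (\<Sum>k\<le>n. \<bar>fps_nth \<phi> k\<bar> * (\<Prod>i=1..k. A * z / q ^ i))"
  proof (intro sum_mono mult_left_mono prod_mono conjI)
    fix k i :: nat assume i: "i \<in> {1..k}"
    show "0 \<le> abs_partial_sum n g (z / q ^ i)"
      using assms by (intro abs_partial_sum_nonneg) auto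
    have "q ^ 1 \<le> q ^ i" using i assms by (intro power_increasing) auto
    then have "z / q ^ i \<le> z / q"
      using assms by (intro divide_left_mono) auto
    also have "\<dots> \<le> x" using assms by (simp add: field_simps)
    finally show "abs_partial_sum n g (z / q ^ i) \<le> A * z / q ^ i"
      using abs_partial_sum_le_scale[OF assms(2) _ _ assms(3), of "z / q ^ i"] assms by simp
  qed auto
  finally show ?thesis .
qed

text \<open>The product equals c^k q^(-k(k+1)/2), and k(k+1)/2 = binom(k-1,2) + 2k - 1 for k > 0. Up
  to a factor \<open>q\<close> this is the growth assumption at the point \<open>c / q ^ 2\<close>,
  with absolute values.\<close>

lemma summable_q_majorant:
  assumes "q > 1" "c > 0"
    and "\<And>z::real. z > 0 \<Longrightarrow> summable (\<lambda>n. fps_nth \<phi> n * z ^ n / q ^ ((n - 1) choose 2))"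
  shows "summable (\<lambda>k. \<bar>fps_nth \<phi> k\<bar> * (\<Prod>i=1..k. c / q ^ i))"
proof -
  let ?b = "\<lambda>n. fps_nth \<phi> n / q ^ ((n - 1) choose 2)"
  have b: "(\<Prod>i=1..k. c / q ^ i) = (c / q ^ 2) ^ k * q / q ^ ((k - 1) choose 2)" if "k > 0" for k
    using that
  proof (induction k rule: nat_induct_non_zero)
    case 1
    then show ?case using assms by (simp add: power2_eq_square binomial_eq_0)
  next
    case (Suc k)
    have k: "Suc k - 1 choose 2 = (k - 1 choose 2) + (k - 1)"
      using Suc.hyps by (cases k) (simp_all add: numeral_2_eq_2)
    have e: "q ^ (k - 1) = q ^ Suc k / q ^ 2"
      using Suc.hyps assms by (cases k) (simp_all add: power2_eq_square)
    show ?case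
      unfolding k power_add e using assms Suc.IH
      by (simp add: field_simps power_mult_distrib power2_eq_square)
  qed
  define z where "z = c / q ^ 2"
  have z: "z > 0" using assms by (simp add: z_def)
  \<comment> \<open>Convergence at the larger point \<open>z + 1\<close> yields absolute convergence
    at \<open>z\<close>, whatever the signs of the coefficients of \<open>\<phi>\<close>.\<close>
  have "summable (\<lambda>n. ?b n * (z + 1) ^ n)"
    using assms(3)[of "z + 1"] z by (simp add: field_simps)
  from powser_insidea[OF this, of z] z have "summable (\<lambda>n. norm (?b n * z ^ n))"
    by simp
  then have "summable (\<lambda>n. norm (?b n * z ^ n) * q)"
    by (rule summable_mult2)
  then show ?thesis
  proof (rule summable_comparison_test')
    fix n :: nat assume "n \<ge> 1"
    then have "n > 0" by simp
    show "norm (\<bar>fps_nth \<phi> n\<bar> * (\<Prod>i=1..n. c / q ^ i)) \<le> norm (?b n * z ^ n) * q"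
      using assms b[OF \<open>n > 0\<close>] z by (simp add: abs_mult flip: z_def)
  qed
qed

subsection \<open>A renewal theorem for generating functions with radius greater than one\<close>

text \<open>The radius of convergence of an inverse is governed by complex zeros, so real series are
  carried over to the complex numbers.\<close>

definition fps_complex_of_real :: "real fps \<Rightarrow> complex fps" where
  "fps_complex_of_real h = Abs_fps (\<lambda>n. of_real (fps_nth h n))"

lemma fps_nth_complex_of_real [simp]:
  "fps_nth (fps_complex_of_real h) n = of_real (fps_nth h n)"
  by (simp add: fps_complex_of_real_def)

lemma fps_conv_radius_complex_of_real [simp]:
  "fps_conv_radius (fps_complex_of_real h) = fps_conv_radius h"
proof -
  have "conv_radius (\<lambda>n. complex_of_real (fps_nth h n)) = conv_radius (\<lambda>n. norm (complex_of_real (fps_nth h n)))"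
    by (rule conv_radius_norm[symmetric])
  also have "\<dots> = conv_radius (\<lambda>n. norm (fps_nth h n))" by simp
  also have "\<dots> = conv_radius (fps_nth h)" by (rule conv_radius_norm)
  finally show ?thesis by (simp add: fps_conv_radius_def)
qed

lemma fps_complex_of_real_mult:
  "fps_complex_of_real (f * g) = fps_complex_of_real f * fps_complex_of_real g"
  by (simp add: fps_eq_iff fps_mult_nth)

lemma fps_complex_of_real_diff:
  "fps_complex_of_real (f - g) = fps_complex_of_real f - fps_complex_of_real g"
  by (simp add: fps_eq_iff)

lemma fps_complex_of_real_1 [simp]: "fps_complex_of_real 1 = 1"
  by (simp add: fps_eq_iff)

lemma fps_complex_of_real_X [simp]: "fps_complex_of_real fps_X = fps_X"
  by (simp add: fps_eq_iff)

lemma eval_fps_complex_of_real: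
  assumes "ereal \<bar>x\<bar> < fps_conv_radius h"
  shows "eval_fps (fps_complex_of_real h) (of_real x) = of_real (eval_fps h x)"
proof -
  have "(\<lambda>n. complex_of_real (fps_nth h n * x ^ n)) sums of_real (eval_fps h x)"
    using assms by (intro sums_of_real sums_eval_fps) auto
  then show ?thesis by (simp add: eval_fps_def sums_iff)
qed

text \<open>By division with remainder, the order of \<open>z\<close> divides every exponent in
  \<open>S\<close>, hence their gcd.\<close>

lemma power_eq_1_imp_eq_1_of_Gcd:
  fixes z :: complex
  assumes "Gcd S = (1::nat)" "\<And>n. n \<in> S \<Longrightarrow> z ^ n = 1"
  shows "z = 1"
proof -
  \<comment> \<open>Otherwise the gcd would be 0; this makes the order well defined.\<close>
  have "\<exists>n\<in>S. n \<noteq> 0"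
    using assms(1) Gcd_0_iff[of S] by force
  then have ex: "\<exists>n. n > 0 \<and> z ^ n = 1" using assms(2) by blast
  define d where "d = (LEAST n. n > 0 \<and> z ^ n = 1)"
  have d: "d > 0" "z ^ d = 1" using LeastI_ex[OF ex] by (auto simp: d_def)
  have "d dvd n" if "n \<in> S" for n
  proof (rule ccontr)
    assume "\<not> d dvd n"
    then have "n mod d > 0" by (simp add: dvd_eq_mod_eq_0)
    have "z ^ n = z ^ (d * (n div d) + n mod d)" by simp
    also have "\<dots> = z ^ (n mod d)" unfolding power_add power_mult d(2) by simp
    finally have "z ^ (n mod d) = 1" using assms(2)[OF that] by simp
    with \<open>n mod d > 0\<close> have "d \<le> n mod d" unfolding d_def by (intro Least_le) auto
    with mod_less_divisor[OF d(1), of n] show False by simp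
  qed
  then have "d dvd Gcd S" by (rule Gcd_greatest)
  with assms(1) have "d = 1" by simp
  with d show ?thesis by simp
qed

text \<open>Equality case of the triangle inequality: the real part of p(1) - p(z) is a sum of
  nonnegative terms equal to 0. Hence \<open>z ^ n\<close> has real part 1 and modulus at most 1 for
  every \<open>n\<close> in the support, so it is 1, and aperiodicity gives
  \<open>z = 1\<close>.\<close>

lemma probability_gf_eq_1_imp:
  fixes p :: "real fps" and z :: complex
  assumes nonneg: "\<And>n. fps_nth p n \<ge> 0" and p: "fps_conv_radius p > 1" "eval_fps p 1 = 1"
    and gcd: "Gcd {n. fps_nth p n \<noteq> 0} = 1"
    and z: "norm z \<le> 1" "eval_fps (fps_complex_of_real p) z = 1"
  shows "z = 1"
proof (rule power_eq_1_imp_eq_1_of_Gcd[OF gcd])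
  have "ereal (norm z) < fps_conv_radius p"
    using z(1) p(1) by (intro order.strict_trans1[OF _ p(1)]) (simp add: one_ereal_def)
  then have "(\<lambda>n. of_real (fps_nth p n) * z ^ n) sums 1"
    using sums_eval_fps[of z "fps_complex_of_real p"] z(2) by simp
  then have "(\<lambda>n. fps_nth p n * Re (z ^ n)) sums 1"
    by (auto simp: sums_complex_iff)
  moreover have "(\<lambda>n. fps_nth p n) sums 1"
    using sums_eval_fps[of 1 p] p by (simp add: one_ereal_def)
  ultimately have "(\<lambda>n. fps_nth p n - fps_nth p n * Re (z ^ n)) sums (1 - 1)"
    by (rule sums_diff[rotated])
  then have s: "(\<lambda>n. fps_nth p n * (1 - Re (z ^ n))) sums 0"
    by (simp add: right_diff_distrib)
  have zn: "norm (z ^ n) \<le> 1" for n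
    using z(1) by (simp add: norm_power power_le_one)
  have le: "Re (z ^ n) \<le> 1" for n
    using zn[of n] complex_Re_le_cmod[of "z ^ n"] by linarith
  fix n assume "n \<in> {n. fps_nth p n \<noteq> 0}"
  moreover have "fps_nth p n * (1 - Re (z ^ n)) = 0"
    using suminf_eq_zero_iff[OF sums_summable[OF s]] s nonneg le by (simp add: sums_iff)
  ultimately have re: "Re (z ^ n) = 1" by simp
  have "(Re (z ^ n))\<^sup>2 + (Im (z ^ n))\<^sup>2 \<le> 1"
    using power_mono[OF zn[of n], of 2] by (simp add: cmod_power2)
  with re have "Im (z ^ n) = 0" by simp
  with re show "z ^ n = 1" by (simp add: complex_eq_iff)
qed

text \<open>Exponential case of the renewal theorem: dividing \<open>1 - p\<close> by \<open>1 - X\<close> gives the series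
  \<open>K\<close> of tail sums, which has no zero in the closed unit disc, so that the coefficients of its
  inverse are summable.\<close>

lemma renewal_limit:
  fixes p :: "real fps"
  assumes nonneg: "\<And>n. fps_nth p n \<ge> 0" and p0: "fps_nth p 0 = 0"
    and radius: "fps_conv_radius p > 1" and total: "eval_fps p 1 = 1"
    and gcd: "Gcd {n. fps_nth p n \<noteq> 0} = 1"
  shows "fps_nth (inverse (1 - p)) \<longlonglongrightarrow> 1 / eval_fps (fps_deriv p) 1"
proof -
  define t where "t n = 1 - (\<Sum>m\<le>n. fps_nth p m)" for n
  define K where "K = Abs_fps t"
  have K: "(1 - fps_X) * K = 1 - p"
  proof (rule fps_ext)
    show "fps_nth ((1 - fps_X) * K) n = fps_nth (1 - p) n" for n
      by (cases n) (simp_all add: K_def t_def left_diff_distrib p0)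
  qed
  have K0: "fps_nth K 0 = 1" by (simp add: K_def t_def p0)

  have psums: "(\<lambda>n. fps_nth p n) sums 1"
    using sums_eval_fps[of 1 p] radius total by (simp add: one_ereal_def)
  have tail: "t n = (\<Sum>m. fps_nth p (m + Suc n))" for n
    using suminf_minus_initial_segment[OF sums_summable[OF psums], of "Suc n"] psums
    by (simp add: t_def sums_iff lessThan_Suc_atMost)
  have t_nonneg: "t n \<ge> 0" for n
    using sums_summable[OF psums] unfolding tail
    by (intro suminf_nonneg nonneg summable_ignore_initial_segment)

  \<comment> \<open>Finiteness of \<open>p\<close> at some \<open>s > 1\<close> makes the tails
    decay geometrically: for tail indices \<open>s ^ n \<le> s ^ (m + Suc n)\<close>, so
    \<open>t n * s ^ n\<close> is at most a tail of the series at \<open>s\<close>.\<close>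
  obtain s where s: "1 < s" "ereal s < fps_conv_radius p"
    using ereal_dense2[OF radius] by (auto simp: one_ereal_def)
  have ssum: "summable (\<lambda>n. fps_nth p n * s ^ n)"
    using s by (intro summable_fps) auto
  have t_le: "t n * s ^ n \<le> eval_fps p s" for n
  proof -
    have "t n * s ^ n = (\<Sum>m. fps_nth p (m + Suc n) * s ^ n)"
      unfolding tail
      by (intro suminf_mult2 summable_ignore_initial_segment sums_summable[OF psums])
    also have "\<dots> \<le> (\<Sum>m. fps_nth p (m + Suc n) * s ^ (m + Suc n))"
    proof (rule suminf_le)
      show "fps_nth p (m + Suc n) * s ^ n \<le> fps_nth p (m + Suc n) * s ^ (m + Suc n)" for m
        using s by (intro mult_left_mono power_increasing nonneg) auto
      show "summable (\<lambda>m. fps_nth p (m + Suc n) * s ^ n)"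
        by (intro summable_mult2 summable_ignore_initial_segment sums_summable[OF psums])
      show "summable (\<lambda>m. fps_nth p (m + Suc n) * s ^ (m + Suc n))"
        using summable_ignore_initial_segment[OF ssum] .
    qed
    also have "\<dots> = eval_fps p s - (\<Sum>m<Suc n. fps_nth p m * s ^ m)"
      unfolding eval_fps_def by (rule suminf_minus_initial_segment[OF ssum])
    also have "\<dots> \<le> eval_fps p s"
      using s nonneg by (simp add: sum_nonneg del: sum.lessThan_Suc)
    finally show ?thesis .
  qed
  \<comment> \<open>Any point strictly between 1 and \<open>s\<close> works; the comparison series
    is geometric with ratio \<open>r / s < 1\<close>.\<close>
  define r where "r = (1 + s) / 2"
  have r: "1 < r" "r < s" using s by (auto simp: r_def)
  have "summable (\<lambda>n. t n * r ^ n)"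
  proof (rule summable_comparison_test')
    show "summable (\<lambda>n. eval_fps p s * (r / s) ^ n)"
      using r by (intro summable_mult summable_geometric) auto
    fix n :: nat
    have "t n * s ^ n * (r / s) ^ n \<le> eval_fps p s * (r / s) ^ n"
      using r by (intro mult_right_mono t_le) auto
    then show "norm (t n * r ^ n) \<le> eval_fps p s * (r / s) ^ n"
      using r t_nonneg[of n] by (simp add: power_divide)
  qed
  from conv_radius_geI[OF this] r have "fps_conv_radius K \<ge> ereal r"
    by (simp add: fps_conv_radius_def K_def)
  moreover have "1 < ereal r" using r by (simp add: one_ereal_def)
  ultimately have radK1: "fps_conv_radius K > 1" by order

  have K1_pos: "eval_fps K 1 \<ge> 1"
  proof -
    have "summable (\<lambda>n. fps_nth K n)"
      using summable_fps[of 1 K] radK1 by (simp add: one_ereal_def)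
    then have "sum (fps_nth K) {0} \<le> suminf (fps_nth K)"
      by (rule sum_le_suminf) (auto simp: K_def t_nonneg)
    then show ?thesis using K0 by (simp add: eval_fps_def)
  qed
  \<comment> \<open>Differentiating p = 1 - (1 - X) K gives p' = K - (1 - X) K', and the second term
    vanishes at 1.\<close>
  have K1: "eval_fps K 1 = eval_fps (fps_deriv p) 1"
  proof -
    have rad: "ereal (norm (1::real)) < fps_conv_radius K" "ereal (norm (1::real)) < fps_conv_radius (fps_deriv K)"
      using radK1 fps_conv_radius_deriv[of K] by (auto simp: one_ereal_def)
    have rad1: "ereal (norm (1::real)) < fps_conv_radius (1 - fps_X :: real fps)"
      using fps_conv_radius_diff[of "1 :: real fps" fps_X] by simp
    have "fps_deriv p = fps_deriv (1 - (1 - fps_X) * K)" unfolding K by simp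
    also have "\<dots> = K - (1 - fps_X) * fps_deriv K" by (simp add: algebra_simps)
    also have "eval_fps \<dots> 1 = eval_fps K 1 - eval_fps ((1 - fps_X) * fps_deriv K) 1"
      using rad rad1 fps_conv_radius_mult[of "1 - fps_X :: real fps" "fps_deriv K"]
      by (intro eval_fps_diff) (auto simp: min_def split: if_splits)
    also have "eval_fps ((1 - fps_X) * fps_deriv K) 1 = eval_fps (1 - fps_X) 1 * eval_fps (fps_deriv K) 1"
      by (rule eval_fps_mult[OF rad1 rad(2)])
    also have "eval_fps (1 - fps_X) (1::real) = 0"
      by (subst eval_fps_diff) auto
    finally show ?thesis by simp
  qed

  define Kc where "Kc = fps_complex_of_real K"
  have radKc: "fps_conv_radius Kc = fps_conv_radius K" by (simp add: Kc_def)
  have evalKc: "(1 - z) * eval_fps Kc z = 1 - eval_fps (fps_complex_of_real p) z"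
    if "ereal (norm z) < fps_conv_radius K" "ereal (norm z) < fps_conv_radius p" for z
  proof -
    have "eval_fps ((1 - fps_X) * Kc) z = eval_fps (1 - fps_complex_of_real p) z"
      using arg_cong[OF K, of "\<lambda>h. eval_fps (fps_complex_of_real h) z"]
      by (simp add: Kc_def fps_complex_of_real_mult fps_complex_of_real_diff)
    moreover have "ereal (norm z) < fps_conv_radius (1 - fps_X :: complex fps)"
      using fps_conv_radius_diff[of "1 :: complex fps" fps_X] by simp
    then have "eval_fps ((1 - fps_X) * Kc) z = eval_fps (1 - fps_X) z * eval_fps Kc z"
      using that(1) radKc by (intro eval_fps_mult) auto
    moreover have "eval_fps (1 - fps_X) z = 1 - z"
      by (subst eval_fps_diff) auto
    moreover have "eval_fps (1 - fps_complex_of_real p) z = 1 - eval_fps (fps_complex_of_real p) z"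
      using that(2) by (subst eval_fps_diff) auto
    ultimately show ?thesis by simp
  qed
  \<comment> \<open>A zero of \<open>Kc\<close> in the closed disc would give p(z) = 1, hence
    \<open>z = 1\<close>, but K(1) is at least 1.\<close>
  have nz: "eval_fps Kc z \<noteq> 0" if z: "norm z \<le> 1" for z
  proof
    assume 0: "eval_fps Kc z = 0"
    have "ereal (norm z) \<le> 1" using z by (simp add: one_ereal_def)
    then have "ereal (norm z) < fps_conv_radius K" "ereal (norm z) < fps_conv_radius p"
      using radK1 radius by order+
    from evalKc[OF this] 0 have "eval_fps (fps_complex_of_real p) z = 1" by simp
    then have "z = 1" by (rule probability_gf_eq_1_imp[OF nonneg radius total gcd z])
    then have "eval_fps Kc z = of_real (eval_fps K 1)"
      using eval_fps_complex_of_real[of 1 K] radK1 by (simp add: Kc_def one_ereal_def)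
    with 0 K1_pos show False by simp
  qed
  \<comment> \<open>A zero-free open disc of radius above 1 is needed to bound the radius of the
    inverse. By compactness either \<open>cball 0 r0\<close> has no zero, and \<open>r0\<close>
    serves, or it has a zero of least modulus, and that modulus serves.\<close>
  obtain R where R: "R > 1" "\<And>z. norm z < R \<Longrightarrow> eval_fps Kc z \<noteq> 0"
  proof -
    obtain r0 where r0: "1 < r0" "ereal r0 < fps_conv_radius K"
      using ereal_dense2[OF radK1] by (auto simp: one_ereal_def)
    define Z where "Z = {z \<in> cball 0 r0. eval_fps Kc z = 0}"
    have "cball 0 r0 \<subseteq> eball (0::complex) (fps_conv_radius Kc)"
    proof
      fix z :: complex assume "z \<in> cball 0 r0"
      then have "ereal (norm z) \<le> ereal r0" by simp
      with r0(2) have "ereal (norm z) < fps_conv_radius Kc" unfolding radKc by order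
      then show "z \<in> eball 0 (fps_conv_radius Kc)" by simp
    qed
    then have "continuous_on (cball 0 r0) (eval_fps Kc)"
      by (rule continuous_on_subset[OF continuous_on_eval_fps])
    then have "closed Z"
      unfolding Z_def by (intro continuous_closed_preimage_constant) auto
    then have "compact (cball 0 r0 \<inter> Z)" by (intro compact_Int_closed) auto
    moreover have "cball 0 r0 \<inter> Z = Z" by (auto simp: Z_def)
    ultimately have Z: "compact Z" by simp
    show thesis
    proof (cases "Z = {}")
      case True
      then show thesis using r0 by (intro that[of r0]) (auto simp: Z_def)
    next
      case False
      obtain z0 where z0: "z0 \<in> Z" "\<And>z. z \<in> Z \<Longrightarrow> norm z0 \<le> norm z"
        using continuous_attains_inf[OF Z False, of norm] continuous_on_norm_id by blast
      show thesis
      proof (rule that)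
        show "norm z0 > 1" using nz[of z0] z0(1) by (force simp: Z_def)
        show "eval_fps Kc z \<noteq> 0" if "norm z < norm z0" for z
        proof
          assume "eval_fps Kc z = 0"
          moreover have "norm z \<le> r0" using z0(1) that by (simp add: Z_def)
          ultimately have "z \<in> Z" by (simp add: Z_def)
          from z0(2)[OF this] that show False by simp
        qed
      qed
    qed
  qed
  have "fps_conv_radius (inverse Kc) \<ge> min (ereal R) (fps_conv_radius Kc)"
    by (rule fps_conv_radius_inverse) (use R in auto)
  moreover have "min (ereal R) (fps_conv_radius Kc) > 1"
    using R(1) radKc radK1 by (simp add: one_ereal_def)
  ultimately have radL: "fps_conv_radius (inverse Kc) > 1" by order
  have "eval_fps (inverse Kc) 1 = inverse (eval_fps Kc 1)"
    by (rule eval_fps_inverse[of "ereal R"]) (use R radKc radK1 in \<open>auto simp: one_ereal_def\<close>)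
  also have "eval_fps Kc 1 = of_real (eval_fps K 1)"
    using eval_fps_complex_of_real[of 1 K] radK1 by (simp add: Kc_def one_ereal_def)
  finally have L1: "eval_fps (inverse Kc) 1 = of_real (1 / eval_fps (fps_deriv p) 1)"
    by (simp add: K1 divide_inverse)

  define L where "L = inverse K"
  have "L * K = 1" unfolding L_def using K0 by (intro inverse_mult_eq_1) auto
  then have "fps_complex_of_real L * Kc = 1"
    by (simp add: Kc_def flip: fps_complex_of_real_mult)
  then have "Kc * fps_complex_of_real L = 1" by (simp add: mult.commute)
  then have "inverse Kc = fps_complex_of_real L"
    by (metis fps_inverse_unique)
  then have "(\<lambda>n. complex_of_real (fps_nth L n)) sums of_real (1 / eval_fps (fps_deriv p) 1)"
    using sums_eval_fps[of 1 "inverse Kc"] radL L1 by (simp add: one_ereal_def)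
  then have Lsums: "fps_nth L sums (1 / eval_fps (fps_deriv p) 1)"
    by (simp only: sums_of_real_iff)

  \<comment> \<open>Since 1/(1 - p) = L/(1 - X), its coefficients are the partial sums of those of
    \<open>L\<close>, which converge to L(1) = 1/K(1).\<close>
  have "(1 - p) * (L * inverse (1 - fps_X)) = (K * L) * ((1 - fps_X) * inverse (1 - fps_X))"
    unfolding K[symmetric] by (simp add: mult_ac)
  also have "\<dots> = 1"
    using \<open>L * K = 1\<close> by (simp add: mult.commute inverse_mult_eq_1')
  finally have "inverse (1 - p) = L * inverse (1 - fps_X)"
    by (metis fps_inverse_unique)
  also have "inverse (1 - fps_X :: real fps) = Abs_fps (\<lambda>n. 1)"
  proof (rule fps_inverse_unique, rule fps_ext)
    show "fps_nth ((1 - fps_X) * Abs_fps (\<lambda>n. 1 :: real)) n = fps_nth 1 n" for n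
      by (cases n) (simp_all add: left_diff_distrib)
  qed
  finally have "fps_nth (inverse (1 - p)) = (\<lambda>n. \<Sum>i\<le>n. fps_nth L i)"
    by (auto simp: fun_eq_iff fps_mult_nth atLeast0AtMost)
  with Lsums show ?thesis by (simp add: sums_def_le)
qed

text \<open>Restricted to degrees up to \<open>n\<close> because the strong induction for the
  coefficients of \<open>g\<close> supplies no more.\<close>

lemma fps_prod_nonneg_upto:
  fixes F :: "'a \<Rightarrow> real fps"
  assumes "\<And>i m. i \<in> A \<Longrightarrow> m \<le> n \<Longrightarrow> fps_nth (F i) m \<ge> 0"
  shows "m \<le> n \<Longrightarrow> fps_nth (\<Prod>i\<in>A. F i) m \<ge> 0"
  using assms
proof (induction A arbitrary: m rule: infinite_finite_induct)
  case (insert a A)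
  then have "fps_nth (F a * (\<Prod>i\<in>A. F i)) m \<ge> 0"
    unfolding fps_mult_nth by (intro sum_nonneg mult_nonneg_nonneg) auto
  with insert.hyps show ?case by simp
qed (auto simp: fps_one_nth)

lemma less_fps_conv_radius_mult:
  fixes f g :: "'a :: {banach, real_normed_div_algebra, comm_ring_1} fps"
  assumes "r < fps_conv_radius f" "r < fps_conv_radius g"
  shows "r < fps_conv_radius (f * g)"
  using assms fps_conv_radius_mult[of f g] by (meson min_less_iff_conj order_less_le_trans)

subsection \<open>Solutions of the equation\<close>

locale q_equation =
  fixes q :: real and \<phi> g :: "real fps"
  assumes q_gt_1: "q > 1"
    and phi_0: "fps_nth \<phi> 0 = 0"
    and solution: "solves_q_equation q (fps_X * (1 - \<phi>)) g"
    and growth: "\<And>z::real. z > 0 \<Longrightarrow> summable (\<lambda>n. fps_nth \<phi> n * z ^ n / q ^ ((n - 1) choose 2))"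
begin

abbreviation U :: "real fps" where "U \<equiv> q_kernel q \<phi> g"

abbreviation P :: "nat \<Rightarrow> real fps" where "P \<equiv> fps_shifted_qprod q g"

lemma g_0: "fps_nth g 0 = 0"
  using solution by (simp add: solves_q_equation_def)

lemma U_0: "fps_nth U 0 = 0"
  by (simp add: q_kernel_def phi_0)

lemma kernel_equation: "g * (1 - U) = fps_X"
  by (rule solves_q_equation_imp_kernel_equation[OF phi_0 solution])

lemma g_eq: "g = fps_X * inverse (1 - U)"
proof -
  have "g = g * ((1 - U) * inverse (1 - U))"
    by (subst inverse_mult_eq_1') (simp_all add: U_0)
  also have "\<dots> = fps_X * inverse (1 - U)"
    by (simp add: kernel_equation flip: mult.assoc)
  finally show ?thesis .
qed

text \<open>The index shift by which the coefficients of \<open>g\<close> become the renewal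
  sequence of \<open>U\<close>.\<close>

lemma g_Suc: "fps_nth g (Suc n) = fps_nth (inverse (1 - U)) n"
  by (subst g_eq) simp

lemma g_1: "fps_nth g (Suc 0) = 1"
  by (simp add: g_Suc U_0)

lemma inverse_eq: "inverse (1 - U) = 1 + U * inverse (1 - U)"
proof -
  have "(1 - U) * inverse (1 - U) = 1"
    by (rule inverse_mult_eq_1') (simp add: U_0)
  then show ?thesis by (simp add: algebra_simps)
qed

text \<open>The renewal identity \<open>inverse_eq\<close> gives s \<le> 1 + a s for the partial sum
  s of \<open>inverse (1 - U)\<close>. The factor X in \<open>g\<close> raises the truncation to
  \<open>Suc n\<close>, which lets the induction on degrees advance.\<close>

lemma abs_partial_sum_Suc_le:
  assumes "x \<ge> 0" "abs_partial_sum n U x \<le> a" "a < 1"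
  shows "abs_partial_sum (Suc n) g x \<le> x / (1 - a)"
proof -
  let ?s = "abs_partial_sum n (inverse (1 - U)) x"
  have "?s \<le> abs_partial_sum n 1 x + abs_partial_sum n (U * inverse (1 - U)) x"
    by (subst inverse_eq) (rule abs_partial_sum_add[OF assms(1)])
  also have "\<dots> \<le> 1 + abs_partial_sum n U x * ?s"
    using abs_partial_sum_mult[OF assms(1)] by simp
  also have "\<dots> \<le> 1 + a * ?s"
    using assms abs_partial_sum_nonneg[of x n "inverse (1 - U)"] by (simp add: mult_right_mono)
  finally have "?s \<le> 1 / (1 - a)"
    using assms by (simp add: field_simps)
  then have "x * ?s \<le> x * (1 / (1 - a))"
    using assms by (intro mult_left_mono) auto
  moreover have "abs_partial_sum (Suc n) g x = x * ?s"
    unfolding abs_partial_sum_def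
    by (subst sum.atMost_Suc_shift) (simp add: g_0 g_Suc sum_distrib_left mult_ac)
  ultimately show ?thesis by simp
qed

text \<open>Induction on the coefficients: a bound \<open>2 x\<close> for the partial sums of \<open>g\<close> at a small \<open>x\<close>
  bounds those of \<open>U\<close> by \<open>1/2\<close>, and this gives back the bound for \<open>g\<close>.\<close>

lemma fps_conv_radius_g_pos: "fps_conv_radius g > 0"
proof -
  let ?m = "\<lambda>c k. \<bar>fps_nth \<phi> k\<bar> * (\<Prod>i=1..k. c / q ^ i)"
  have m1: "summable (?m 1)"
    using q_gt_1 growth by (intro summable_q_majorant) auto
  have m1_nonneg: "?m 1 k \<ge> 0" for k
    using q_gt_1 by (intro mult_nonneg_nonneg prod_nonneg) auto
  define S where "S = suminf (?m 1)"
  have S: "S \<ge> 0" unfolding S_def by (rule suminf_nonneg[OF m1 m1_nonneg])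
  \<comment> \<open>Chosen so that \<open>c * S \<le> 1 / 2\<close>. As \<open>c \<le> 1\<close> and
    \<open>\<phi>\<close> has no constant term, \<open>c ^ k \<le> c\<close> holds wherever it is
    used, and the majorant at \<open>c\<close> is at most \<open>c * S\<close>.\<close>
  define c where "c = 1 / (2 * (S + 1))"
  have c: "c > 0" "c \<le> 1" "c * S \<le> 1 / 2" using S by (auto simp: c_def field_simps)
  have small: "(\<Sum>k\<le>n. ?m c k) \<le> 1 / 2" for n
  proof -
    have "(\<Sum>k\<le>n. ?m c k) \<le> (\<Sum>k\<le>n. c * ?m 1 k)"
    proof (rule sum_mono)
      fix k
      show "?m c k \<le> c * ?m 1 k"
      proof (cases k)
        case (Suc j)
        have "(\<Prod>i=1..k. c / q ^ i) = c ^ k * (\<Prod>i=1..k. 1 / q ^ i)"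
          by (simp add: prod_dividef)
        moreover have "c ^ k \<le> c"
          using c Suc power_decreasing[of 1 k c] by simp
        ultimately have "?m c k = c ^ k * ?m 1 k" "c ^ k * ?m 1 k \<le> c * ?m 1 k"
          using m1_nonneg by (auto intro!: mult_right_mono)
        then show ?thesis by (simp only:)
      qed (simp add: phi_0)
    qed
    also have "\<dots> = c * (\<Sum>k\<le>n. ?m 1 k)" by (simp add: sum_distrib_left)
    also have "\<dots> \<le> c * S"
      unfolding S_def using c m1_nonneg by (intro mult_left_mono sum_le_suminf m1) auto
    finally show ?thesis using c by simp
  qed
  define x where "x = c / 2"
  have x: "x > 0" "2 * x = c" using c by (auto simp: x_def)
  have "abs_partial_sum n g x \<le> 2 * x" for n
  proof (induction n)
    case 0
    then show ?case using x by (simp add: abs_partial_sum_def g_0)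
  next
    case (Suc n)
    have "abs_partial_sum n U x \<le> (\<Sum>k\<le>n. ?m (2 * x) k)"
      using x q_gt_1 by (intro abs_partial_sum_q_kernel_le[OF q_gt_1 g_0 Suc.IH]) auto
    with small[of n] have "abs_partial_sum n U x \<le> 1 / 2" by (simp add: x(2))
    with x abs_partial_sum_Suc_le[of x n "1 / 2"] show ?case by simp
  qed
  with x have "fps_conv_radius g \<ge> ereal x"
    by (intro fps_conv_radius_geI_abs_partial_sum) auto
  moreover have "ereal x > 0" using x by simp
  ultimately show ?thesis by order
qed

text \<open>Slightly beyond \<open>x\<close> the partial sums of \<open>g\<close> are still bounded,
  and a linear bound at \<open>r\<close> controls the kernel at \<open>q * r\<close>.\<close>

lemma less_fps_conv_radius_U:
  assumes "x \<ge> 0" "ereal x < fps_conv_radius g"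
  shows "ereal (q * x) < fps_conv_radius U"
proof -
  obtain r where r: "x < r" "ereal r < fps_conv_radius g"
    using ereal_dense2[OF assms(2)] by auto
  with assms have r0: "r > 0" by simp
  obtain B where B: "B \<ge> 0" "\<And>n. abs_partial_sum n g r \<le> B"
    using abs_partial_sum_bounded[of r g] r r0 by auto
  \<comment> \<open>The summand 1 keeps \<open>A\<close> positive even if \<open>B = 0\<close>, as
    the majorant lemma requires.\<close>
  define A where "A = (B + 1) / r"
  have A: "A > 0" "abs_partial_sum n g r \<le> A * r" for n
    using B(1) B(2)[of n] r0 by (auto simp: A_def)
  let ?m = "\<lambda>k. \<bar>fps_nth \<phi> k\<bar> * (\<Prod>i=1..k. A * (q * r) / q ^ i)"
  have m: "summable ?m"
    using q_gt_1 A r0 growth by (intro summable_q_majorant) auto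
  have "abs_partial_sum n U (q * r) \<le> suminf ?m" for n
  proof -
    have "abs_partial_sum n U (q * r) \<le> (\<Sum>k\<le>n. ?m k)"
      using q_gt_1 r0 by (intro abs_partial_sum_q_kernel_le[OF q_gt_1 g_0 A(2)]) auto
    also have "\<dots> \<le> suminf ?m"
      using q_gt_1 r0 A(1)
      by (intro sum_le_suminf[OF m] mult_nonneg_nonneg prod_nonneg) auto
    finally show ?thesis .
  qed
  then have "ereal (q * r) \<le> fps_conv_radius U"
    using q_gt_1 r0 by (intro fps_conv_radius_geI_abs_partial_sum) auto
  moreover have "ereal (q * x) < ereal (q * r)" using r q_gt_1 by simp
  ultimately show ?thesis by order
qed

end

section \<open>Nonnegative coefficients: finiteness of the radius and the value of \<open>U\<close>
  there\<close>

locale nonneg_q_equation = q_equation +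
  assumes phi_nonneg: "\<And>n. fps_nth \<phi> n \<ge> 0" and phi_nonzero: "\<phi> \<noteq> 0"
begin

lemma P_nonneg_upto:
  assumes "\<And>m. m \<le> n \<Longrightarrow> fps_nth g m \<ge> 0" "m \<le> n"
  shows "fps_nth (P k) m \<ge> 0"
  unfolding fps_shifted_qprod_def using assms q_gt_1
  by (intro fps_prod_nonneg_upto[of _ n]) auto

text \<open>Strong induction through g = X + U g. As \<open>U\<close> and \<open>g\<close> have no
  constant term, the coefficient in degree \<open>n\<close> involves both only in lower degrees, and
  the coefficients of \<open>U\<close> below \<open>n\<close> depend on those of \<open>g\<close>
  below \<open>n\<close>.\<close>

lemma g_nonneg: "fps_nth g n \<ge> 0"
proof (induction n rule: less_induct)
  case (less n)
  show ?case
  proof (cases n)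
    case (Suc n')
    have U: "fps_nth U m \<ge> 0" if "m \<le> n'" for m
      unfolding q_kernel_def fps_nth_Abs_fps using that less Suc phi_nonneg
      by (intro sum_nonneg mult_nonneg_nonneg P_nonneg_upto[of n']) auto
    have "g = fps_X + U * g"
      using kernel_equation by (simp add: algebra_simps)
    then have "fps_nth g n = fps_nth fps_X n + (\<Sum>i=0..n. fps_nth U i * fps_nth g (n - i))"
      by (metis fps_add_nth fps_mult_nth)
    moreover have "fps_nth U i * fps_nth g (n - i) \<ge> 0" if i: "i \<in> {0..n}" for i
    proof -
      consider "i = 0" | "i = n" | "i \<noteq> 0" "i < n" using i by fastforce
      then show ?thesis
        by cases (use U[of i] less[of "n - i"] Suc in \<open>auto simp: U_0 g_0\<close>)
    qed
    then have "(\<Sum>i=0..n. fps_nth U i * fps_nth g (n - i)) \<ge> 0"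
      by (rule sum_nonneg)
    ultimately show ?thesis by simp
  qed (simp add: g_0)
qed

lemma P_nonneg: "fps_nth (P k) m \<ge> 0"
  by (rule P_nonneg_upto[OF g_nonneg order_refl])

lemma U_nonneg: "fps_nth U n \<ge> 0"
  unfolding q_kernel_def by (simp add: sum_nonneg phi_nonneg P_nonneg)

text \<open>The term with index \<open>k\<close> is already positive, by the diagonal coefficient
  and g'(0) = 1. So the support of \<open>\<phi>\<close> lies in that of \<open>U\<close>.\<close>

lemma U_pos:
  assumes "fps_nth \<phi> k \<noteq> 0"
  shows "fps_nth U k > 0"
proof -
  have "0 < fps_nth \<phi> k * fps_nth (P k) k"
    using assms phi_nonneg[of k] q_gt_1
    by (auto simp: fps_nth_shifted_qprod_diag[OF g_0] g_1 intro!: mult_pos_pos prod_pos)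
  also have "\<dots> \<le> fps_nth U k"
    unfolding q_kernel_def fps_nth_Abs_fps
    by (rule member_le_sum) (auto simp: phi_nonneg P_nonneg)
  finally show ?thesis .
qed

lemma obtain_U_pos:
  obtains k where "k > 0" "fps_nth U k > 0"
proof -
  obtain k where "fps_nth \<phi> k \<noteq> 0" using phi_nonzero by (auto simp: fps_eq_iff)
  with phi_0 U_pos[of k] that[of k] show thesis by (cases k) auto
qed

lemma less_fps_conv_radius_U':
  assumes "x \<ge> 0" "ereal x < fps_conv_radius g"
  shows "ereal x < fps_conv_radius U"
proof -
  have "1 * x \<le> q * x" using assms q_gt_1 by (intro mult_right_mono) auto
  then have "ereal x \<le> ereal (q * x)" by simp
  with less_fps_conv_radius_U[OF assms] show ?thesis by order
qed

lemma eval_g_ge: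
  assumes "x \<ge> 0" "ereal x < fps_conv_radius g"
  shows "x \<le> eval_fps g x"
proof -
  have "x = abs_partial_sum 1 g x"
    by (simp add: abs_partial_sum_def g_0 g_1)
  also have "\<dots> \<le> eval_fps g x"
    by (rule abs_partial_sum_le_eval_fps[OF assms g_nonneg])
  finally show ?thesis .
qed

text \<open>Inside the disc g(x) (1 - U(x)) = x > 0, and g(x) > 0.\<close>

lemma eval_U_less_1:
  assumes "x > 0" "ereal x < fps_conv_radius g"
  shows "eval_fps U x < 1"
proof -
  have r: "ereal (norm x) < fps_conv_radius g" "ereal (norm x) < fps_conv_radius U"
    using assms less_fps_conv_radius_U'[of x] by auto
  have r1: "ereal (norm x) < fps_conv_radius (1 - U)"
    using r fps_conv_radius_diff[of 1 U] by simp
  have "x = eval_fps (g * (1 - U)) x" by (simp add: kernel_equation)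
  also have "\<dots> = eval_fps g x * eval_fps (1 - U) x"
    by (rule eval_fps_mult[OF r(1) r1])
  also have "eval_fps (1 - U) x = 1 - eval_fps U x"
    using r by (subst eval_fps_diff) auto
  finally have "0 < eval_fps g x * (1 - eval_fps U x)" using assms by simp
  moreover have "eval_fps g x > 0" using eval_g_ge[of x] assms by simp
  ultimately show ?thesis by (simp add: zero_less_mult_iff)
qed

text \<open>With an infinite radius \<open>U\<close> would stay below 1 on the whole positive axis,
  although it contains a monomial with positive coefficient and degree.\<close>

lemma fps_conv_radius_g_finite: "fps_conv_radius g \<noteq> \<infinity>"
proof
  assume inf: "fps_conv_radius g = \<infinity>"
  obtain k where k: "k > 0" "fps_nth U k > 0" by (rule obtain_U_pos)
  define x where "x = max 1 (1 / fps_nth U k)"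
  have x: "x \<ge> 1" "1 / fps_nth U k \<le> x" by (auto simp: x_def)
  have "1 \<le> fps_nth U k * x" using x(2) k(2) by (simp add: field_simps)
  also have "\<dots> \<le> fps_nth U k * x ^ k"
    using k x power_increasing[of 1 k x] by (intro mult_left_mono) auto
  also have "\<dots> \<le> abs_partial_sum k U x"
    unfolding abs_partial_sum_def using x U_nonneg
    by (intro order.trans[OF _ member_le_sum[of k]]) auto
  also have "\<dots> \<le> eval_fps U x"
    using x less_fps_conv_radius_U'[of x] inf
    by (intro abs_partial_sum_le_eval_fps U_nonneg) auto
  finally show False using eval_U_less_1[of x] x inf by simp
qed

definition \<eta> :: real where "\<eta> = real_of_ereal (fps_conv_radius g)"

lemma fps_conv_radius_g: "fps_conv_radius g = ereal \<eta>"
  using fps_conv_radius_g_pos fps_conv_radius_g_finite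
  by (cases "fps_conv_radius g") (auto simp: \<eta>_def)

lemma eta_pos: "\<eta> > 0"
  using fps_conv_radius_g_pos by (simp add: fps_conv_radius_g)

text \<open>The gain of a factor \<open>q\<close>, applied at the interior point
  \<open>\<eta> / q\<close>; it makes \<open>U\<close> analytic across
  \<open>\<eta>\<close>.\<close>

lemma eta_less_fps_conv_radius_U: "ereal \<eta> < fps_conv_radius U"
  using less_fps_conv_radius_U[of "\<eta> / q"] eta_pos q_gt_1
  by (simp add: fps_conv_radius_g field_simps)

text \<open>Continuity from the left gives \<open>\<le>\<close>. If the value were below 1, so would
  be U(r) for some \<open>r > \<eta>\<close>, and \<open>abs_partial_sum_Suc_le\<close> would make
  \<open>g\<close> converge beyond its radius.\<close>

lemma eval_U_eta: "eval_fps U \<eta> = 1"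
proof (rule antisym)
  have "isCont (eval_fps U) \<eta>"
    using has_field_derivative_eval_fps[of \<eta> U] eta_less_fps_conv_radius_U eta_pos
    by (intro DERIV_isCont) auto
  then have left: "(eval_fps U \<longlongrightarrow> eval_fps U \<eta>) (at_left \<eta>)"
    and right: "(eval_fps U \<longlongrightarrow> eval_fps U \<eta>) (at_right \<eta>)"
    by (auto simp: isCont_def filterlim_at_split)
  have "eventually (\<lambda>x. x \<in> {0<..<\<eta>}) (at_left \<eta>)"
    by (rule eventually_at_left_real[OF eta_pos])
  then have "eventually (\<lambda>x. eval_fps U x \<le> 1) (at_left \<eta>)"
    by eventually_elim (auto intro!: less_imp_le eval_U_less_1 simp: fps_conv_radius_g)
  with left show "eval_fps U \<eta> \<le> 1"
    by (rule tendsto_upperbound) simp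
  show "1 \<le> eval_fps U \<eta>"
  proof (rule ccontr)
    assume "\<not> 1 \<le> eval_fps U \<eta>"
    then have ev: "eventually (\<lambda>x. eval_fps U x < 1) (at_right \<eta>)"
      by (intro order_tendstoD(2)[OF right]) auto
    obtain s where s: "\<eta> < s" "ereal s < fps_conv_radius U"
      using ereal_dense2[OF eta_less_fps_conv_radius_U] by auto
    have "eventually (\<lambda>x. x \<in> {\<eta><..<s} \<and> eval_fps U x < 1) (at_right \<eta>)"
      using eventually_at_right_real[OF s(1)] ev by (rule eventually_conj)
    then obtain r where r: "\<eta> < r" "r < s" "eval_fps U r < 1"
      using eventually_happens[of _ "at_right \<eta>"] by force
    have rU: "ereal r < fps_conv_radius U" 
      using r s by (meson ereal_less_le less_eq_ereal_def less_ereal.simps(1) order.strict_trans)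
    have "abs_partial_sum n g r \<le> r / (1 - eval_fps U r)" for n
    proof (cases n)
      case 0
      then show ?thesis using r eta_pos by (simp add: abs_partial_sum_def g_0)
    next
      case (Suc n')
      have "abs_partial_sum n' U r \<le> eval_fps U r"
        using r eta_pos rU by (intro abs_partial_sum_le_eval_fps U_nonneg) auto
      then show ?thesis
        unfolding Suc using r eta_pos by (intro abs_partial_sum_Suc_le) auto
    qed
    then have "ereal r \<le> fps_conv_radius g"
      using r eta_pos by (intro fps_conv_radius_geI_abs_partial_sum) auto
    with r show False by (simp add: fps_conv_radius_g)
  qed
qed

section \<open>The two series of the theorem as values of \<open>U\<close> and its derivative at
  \<open>\<eta>\<close>\<close>

lemma eval_fps_qdilate: "eval_fps (fps_qdilate q g i) x = eval_fps g (x / q ^ i)"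
  by (simp add: eval_fps_def power_divide power_mult)

lemma eta_div_less: "i > 0 \<Longrightarrow> \<eta> / q ^ i < \<eta>"
  using eta_pos q_gt_1 one_less_power[of q i] by (simp add: field_simps)

lemma eta_less_fps_conv_radius_qdilate:
  assumes "i > 0"
  shows "ereal \<eta> < fps_conv_radius (fps_qdilate q g i)"
proof -
  have "fps_conv_radius (fps_qdilate q g i) = conv_radius (\<lambda>n. (1 / q ^ i) ^ n * fps_nth g n)"
    by (simp add: fps_conv_radius_def power_divide power_mult)
  also have "\<dots> = fps_conv_radius g / ereal (norm (1 / q ^ i))"
    unfolding fps_conv_radius_def using q_gt_1 by (intro conv_radius_mult_power) auto
  also have "\<dots> = ereal (\<eta> * q ^ i)"
    using q_gt_1 by (simp add: fps_conv_radius_g)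
  finally show ?thesis
    using eta_div_less[OF assms] q_gt_1 by (simp add: field_simps)
qed

lemma eval_fps_deriv_qdilate:
  assumes "i > 0"
  shows "eval_fps (fps_deriv (fps_qdilate q g i)) \<eta> = 1 / q ^ i * eval_fps (fps_deriv g) (\<eta> / q ^ i)"
proof -
  have "ereal (norm (\<eta> / q ^ i)) < fps_conv_radius g"
    using eta_div_less[OF assms] eta_pos q_gt_1 by (simp add: fps_conv_radius_g)
  also have "\<dots> \<le> fps_conv_radius (fps_deriv g)" by (rule fps_conv_radius_deriv)
  finally have "(\<lambda>n. 1 / q ^ i * (fps_nth (fps_deriv g) n * (\<eta> / q ^ i) ^ n)) sums
      (1 / q ^ i * eval_fps (fps_deriv g) (\<eta> / q ^ i))"
    by (intro sums_mult sums_eval_fps)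
  moreover have "1 / q ^ i * (fps_nth (fps_deriv g) n * (\<eta> / q ^ i) ^ n)
      = fps_nth (fps_deriv (fps_qdilate q g i)) n * \<eta> ^ n" for n
    by (simp add: power_divide power_mult power_add)
  ultimately show ?thesis by (simp add: eval_fps_def sums_iff)
qed

lemma eta_less_fps_conv_radius_P: "ereal \<eta> < fps_conv_radius (P k)"
proof (induction k)
  case (Suc k)
  then have "ereal \<eta> < fps_conv_radius (P k * fps_qdilate q g (Suc k))"
    by (intro less_fps_conv_radius_mult eta_less_fps_conv_radius_qdilate) auto
  then show ?case by (simp add: fps_shifted_qprod_def)
qed (simp add: fps_shifted_qprod_def)

lemma P_Suc: "P (Suc k) = P k * fps_qdilate q g (Suc k)"
  by (simp add: fps_shifted_qprod_def)

lemma eval_P: "eval_fps (P k) \<eta> = eval_qprod q g \<eta> k"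
proof (induction k)
  case (Suc k)
  have "eval_fps (P k * fps_qdilate q g (Suc k)) \<eta> = eval_fps (P k) \<eta> * eval_fps (fps_qdilate q g (Suc k)) \<eta>"
    using eta_pos eta_less_fps_conv_radius_P[of k] eta_less_fps_conv_radius_qdilate[of "Suc k"]
    by (intro eval_fps_mult) auto
  then show ?case by (simp add: P_Suc Suc.IH eval_fps_qdilate eval_qprod_def)
qed (simp add: fps_shifted_qprod_def eval_qprod_def)

text \<open>Product rule by induction on \<open>k\<close>; it takes logarithmic form because
  \<open>g\<close> is positive at the points \<open>\<eta> / q ^ i\<close>.\<close>

lemma eval_fps_deriv_P:
  "eval_fps (fps_deriv (P k)) \<eta> = eval_qprod q g \<eta> k * eval_qlogderiv q g \<eta> k"
proof (induction k)
  case (Suc k)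
  let ?D = "fps_qdilate q g (Suc k)"
  have r: "ereal (norm \<eta>) < fps_conv_radius (P k)" "ereal (norm \<eta>) < fps_conv_radius ?D"
    using eta_pos eta_less_fps_conv_radius_P[of k] eta_less_fps_conv_radius_qdilate[of "Suc k"] by auto
  then have r': "ereal (norm \<eta>) < fps_conv_radius (fps_deriv (P k))" "ereal (norm \<eta>) < fps_conv_radius (fps_deriv ?D)"
    using fps_conv_radius_deriv[of "P k"] fps_conv_radius_deriv[of ?D] by order+
  have "\<eta> / q ^ Suc k > 0" using eta_pos q_gt_1 by simp
  moreover have "ereal (\<eta> / q ^ Suc k) < fps_conv_radius g"
    using eta_div_less[of "Suc k"] by (simp add: fps_conv_radius_g)
  ultimately have nz: "eval_fps g (\<eta> / q ^ Suc k) > 0"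
    using eval_g_ge[of "\<eta> / q ^ Suc k"] by linarith
  have "eval_fps (fps_deriv (P (Suc k))) \<eta> = eval_fps (P k * fps_deriv ?D + fps_deriv (P k) * ?D) \<eta>"
    by (simp add: P_Suc)
  also have "\<dots> = eval_fps (P k) \<eta> * eval_fps (fps_deriv ?D) \<eta> + eval_fps (fps_deriv (P k)) \<eta> * eval_fps ?D \<eta>"
    using r r' by (subst eval_fps_add) (auto intro!: less_fps_conv_radius_mult simp: eval_fps_mult)
  also have "\<dots> = eval_qprod q g \<eta> k * (1 / q ^ Suc k * eval_fps (fps_deriv g) (\<eta> / q ^ Suc k))
      + eval_qprod q g \<eta> k * eval_qlogderiv q g \<eta> k * eval_fps g (\<eta> / q ^ Suc k)"
    by (simp only: eval_P Suc.IH eval_fps_qdilate eval_fps_deriv_qdilate[OF zero_less_Suc])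
  also have "\<dots> = eval_qprod q g \<eta> k * eval_fps g (\<eta> / q ^ Suc k) *
      (eval_qlogderiv q g \<eta> k + 1 / q ^ Suc k * (eval_fps (fps_deriv g) (\<eta> / q ^ Suc k) / eval_fps g (\<eta> / q ^ Suc k)))"
    using nz by (simp add: field_simps del: power_Suc)
  also have "\<dots> = eval_qprod q g \<eta> (Suc k) * eval_qlogderiv q g \<eta> (Suc k)"
    by (simp add: eval_qprod_def eval_qlogderiv_def)
  finally show ?case .
qed (simp add: fps_shifted_qprod_def eval_qlogderiv_def)

text \<open>Interchange of the sums over \<open>k\<close> and over degrees; for a fixed degree the
  sum over \<open>k\<close> is finite.\<close>

lemma sums_eval_U: "(\<lambda>k. fps_nth \<phi> k * eval_qprod q g \<eta> k) sums eval_fps U \<eta>"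
proof (rule sums_swap_nonneg)
  show "fps_nth \<phi> k * (fps_nth (P k) n * \<eta> ^ n) \<ge> 0" for k n
    using eta_pos by (intro mult_nonneg_nonneg phi_nonneg P_nonneg) auto
  show "(\<lambda>n. fps_nth \<phi> k * (fps_nth (P k) n * \<eta> ^ n)) sums (fps_nth \<phi> k * eval_qprod q g \<eta> k)" for k
    unfolding eval_P[symmetric] using eta_pos eta_less_fps_conv_radius_P
    by (intro sums_mult sums_eval_fps) auto
  show "(\<lambda>k. fps_nth \<phi> k * (fps_nth (P k) n * \<eta> ^ n)) sums (fps_nth U n * \<eta> ^ n)" for n
  proof -
    have "(\<lambda>k. fps_nth \<phi> k * fps_nth (P k) n) sums fps_nth U n"
      unfolding q_kernel_def fps_nth_Abs_fps
      by (rule sums_finite) (auto simp: fps_nth_shifted_qprod_eq_0[OF g_0])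
    from sums_mult2[OF this, of "\<eta> ^ n"] show ?thesis by (simp add: mult.assoc)
  qed
  show "(\<lambda>n. fps_nth U n * \<eta> ^ n) sums eval_fps U \<eta>"
    using eta_pos eta_less_fps_conv_radius_U by (intro sums_eval_fps) auto
qed

lemma eta_less_fps_conv_radius_deriv_U: "ereal (norm \<eta>) < fps_conv_radius (fps_deriv U)"
  using eta_pos eta_less_fps_conv_radius_U fps_conv_radius_deriv[of U]
  by (auto intro: order.strict_trans2)

lemma sums_eval_deriv_U:
  "(\<lambda>k. fps_nth \<phi> k * eval_qprod q g \<eta> k * eval_qlogderiv q g \<eta> k) sums eval_fps (fps_deriv U) \<eta>"
proof (rule sums_swap_nonneg)
  show "fps_nth \<phi> k * (fps_nth (fps_deriv (P k)) n * \<eta> ^ n) \<ge> 0" for k n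
    using eta_pos P_nonneg[of k "Suc n"] by (intro mult_nonneg_nonneg phi_nonneg) auto
  show "(\<lambda>n. fps_nth \<phi> k * (fps_nth (fps_deriv (P k)) n * \<eta> ^ n)) sums
      (fps_nth \<phi> k * eval_qprod q g \<eta> k * eval_qlogderiv q g \<eta> k)" for k
    unfolding mult.assoc eval_fps_deriv_P[symmetric]
    using eta_pos eta_less_fps_conv_radius_P[of k] fps_conv_radius_deriv[of "P k"]
    by (intro sums_mult sums_eval_fps) (auto intro: order.strict_trans2)
  show "(\<lambda>k. fps_nth \<phi> k * (fps_nth (fps_deriv (P k)) n * \<eta> ^ n)) sums (fps_nth (fps_deriv U) n * \<eta> ^ n)" for n
  proof -
    have "(\<lambda>k. fps_nth \<phi> k * fps_nth (P k) (Suc n)) sums fps_nth U (Suc n)"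
      unfolding q_kernel_def fps_nth_Abs_fps
      by (rule sums_finite) (auto simp: fps_nth_shifted_qprod_eq_0[OF g_0])
    from sums_mult2[OF this, of "real (Suc n) * \<eta> ^ n"] show ?thesis by (simp add: mult_ac)
  qed
  show "(\<lambda>n. fps_nth (fps_deriv U) n * \<eta> ^ n) sums eval_fps (fps_deriv U) \<eta>"
    by (rule sums_eval_fps[OF eta_less_fps_conv_radius_deriv_U])
qed

text \<open>One positive coefficient of positive degree suffices. This allows the constant
  \<open>C\<close> to be defined as the reciprocal.\<close>

lemma eval_deriv_U_pos: "eval_fps (fps_deriv U) \<eta> > 0"
proof -
  obtain k where k: "k > 0" "fps_nth U k > 0" by (rule obtain_U_pos)
  have "0 < fps_nth (fps_deriv U) (k - 1) * \<eta> ^ (k - 1)"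
    using k eta_pos by simp
  also have "\<dots> \<le> (\<Sum>n\<le>k-1. \<bar>fps_nth (fps_deriv U) n\<bar> * \<eta> ^ n)"
    using U_nonneg eta_pos
    by (intro order.trans[OF _ member_le_sum[of "k - 1"]]) auto
  also have "\<dots> \<le> eval_fps (fps_deriv U) \<eta>"
    using abs_partial_sum_le_eval_fps[of \<eta> "fps_deriv U"] eta_pos
      eta_less_fps_conv_radius_deriv_U U_nonneg by (simp add: abs_partial_sum_def)
  finally show ?thesis .
qed

section \<open>Asymptotics of the coefficients\<close>

text \<open>Rescaling the variable by \<open>\<eta>\<close> turns \<open>U\<close> into the
  generating function \<open>p\<close> of a probability distribution with radius above 1, to which
  \<open>renewal_limit\<close> applies.\<close>

lemma g_limit:
  assumes "Gcd {n. fps_nth \<phi> n \<noteq> 0} = 1"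
  shows "(\<lambda>n. fps_nth g n * \<eta> ^ n) \<longlonglongrightarrow> 1 / eval_fps (fps_deriv U) \<eta>"
proof -
  let ?X = "fps_const \<eta> * fps_X :: real fps"
  define p where "p = fps_compose U ?X"
  have p_nth: "fps_nth p n = \<eta> ^ n * fps_nth U n" for n by (simp add: p_def)
  obtain s where s: "\<eta> < s" "ereal s < fps_conv_radius U"
    using ereal_dense2[OF eta_less_fps_conv_radius_U] by auto
  have lim: "fps_nth (inverse (1 - p)) \<longlonglongrightarrow> 1 / eval_fps (fps_deriv p) 1"
  proof (rule renewal_limit)
    show "fps_nth p n \<ge> 0" for n using eta_pos U_nonneg by (simp add: p_nth)
    show "fps_nth p 0 = 0" by (simp add: p_nth U_0)
    have "summable (\<lambda>n. fps_nth U n * s ^ n)"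
      using s eta_pos by (intro summable_fps) auto
    then have "summable (\<lambda>n. fps_nth p n * (s / \<eta>) ^ n)"
      using eta_pos by (simp add: p_nth power_divide mult.commute)
    from conv_radius_geI[OF this] have "fps_conv_radius p \<ge> ereal (s / \<eta>)"
      using s eta_pos by (simp add: fps_conv_radius_def)
    moreover have "1 < ereal (s / \<eta>)" using s eta_pos by (simp add: one_ereal_def)
    ultimately show "fps_conv_radius p > 1" by order
    show "eval_fps p 1 = 1"
      using eval_U_eta by (simp add: eval_fps_def p_nth mult.commute)
    \<comment> \<open>The support of \<open>p\<close> contains that of \<open>\<phi>\<close>, so
      aperiodicity carries over.\<close>
    have "Gcd {n. fps_nth p n \<noteq> 0} dvd Gcd {n. fps_nth \<phi> n \<noteq> 0}"
    proof (rule Gcd_greatest)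
      fix n assume "n \<in> {n. fps_nth \<phi> n \<noteq> 0}"
      with U_pos[of n] eta_pos show "Gcd {n. fps_nth p n \<noteq> 0} dvd n"
        by (intro Gcd_dvd) (auto simp: p_nth)
    qed
    with assms show "Gcd {n. fps_nth p n \<noteq> 0} = 1" by simp
  qed
  have deriv: "eval_fps (fps_deriv p) 1 = \<eta> * eval_fps (fps_deriv U) \<eta>"
  proof -
    have "(\<lambda>n. \<eta> * (fps_nth (fps_deriv U) n * \<eta> ^ n)) sums (\<eta> * eval_fps (fps_deriv U) \<eta>)"
      by (intro sums_mult sums_eval_fps eta_less_fps_conv_radius_deriv_U)
    then show ?thesis by (simp add: eval_fps_def p_nth sums_iff mult_ac)
  qed
  have "(1 - p) * fps_compose (inverse (1 - U)) ?X = fps_compose ((1 - U) * inverse (1 - U)) ?X"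
    by (simp add: p_def fps_compose_mult_distrib fps_compose_sub_distrib)
  also have "\<dots> = 1" by (subst inverse_mult_eq_1') (simp_all add: U_0)
  finally have "inverse (1 - p) = fps_compose (inverse (1 - U)) ?X"
    by (metis fps_inverse_unique)
  then have inv: "fps_nth (inverse (1 - p)) n = \<eta> ^ n * fps_nth g (Suc n)" for n
    by (simp add: g_Suc)
  \<comment> \<open>The extra \<open>\<eta>\<close> cancels the one in p'(1) = \<eta> U'(\<eta>) and
    completes the power to \<open>\<eta> ^ Suc n\<close>.\<close>
  have "(\<lambda>n. \<eta> * fps_nth (inverse (1 - p)) n) \<longlonglongrightarrow> \<eta> * (1 / eval_fps (fps_deriv p) 1)"
    by (intro tendsto_mult_left lim)
  then have "(\<lambda>n. fps_nth g (Suc n) * \<eta> ^ Suc n) \<longlonglongrightarrow> 1 / eval_fps (fps_deriv U) \<eta>"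
    using eta_pos by (simp add: inv deriv mult_ac)
  then show ?thesis by (rule LIMSEQ_imp_Suc)
qed

end

theorem theorem5p1:
  fixes q :: real and \<phi> f g :: "real fps"
  assumes "q > 1"
    and "fps_nth \<phi> 0 = 0"
    and "f = fps_X * (1 - \<phi>)"
    and "solves_q_equation q f g"
    and "\<And>z::real. z > 0 \<Longrightarrow> summable (\<lambda>n. fps_nth \<phi> n * z ^ n / q ^ ((n - 1) choose 2))"
  shows "fps_conv_radius g > 0 \<and>
    ((\<forall>n. fps_nth \<phi> n \<ge> 0) \<and> \<phi> \<noteq> 0 \<longrightarrow>
      (\<exists>\<eta> C :: real. \<eta> > 0 \<and> fps_conv_radius g = ereal \<eta> \<and>
         (\<lambda>k. fps_nth \<phi> k * eval_qprod q g \<eta> k) sums 1 \<and>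
         C \<noteq> 0 \<and>
         (\<lambda>k. fps_nth \<phi> k * eval_qprod q g \<eta> k * eval_qlogderiv q g \<eta> k) sums (1 / C) \<and>
         (Gcd {n. fps_nth \<phi> n \<noteq> 0} = 1 \<longrightarrow>
            (\<lambda>n. fps_nth g n) \<sim>[at_top] (\<lambda>n. C / \<eta> ^ n))))"
proof (intro conjI impI)
  interpret q_equation q \<phi> g
    using assms by unfold_locales auto
  show "fps_conv_radius g > 0" by (rule fps_conv_radius_g_pos)
  assume "(\<forall>n. fps_nth \<phi> n \<ge> 0) \<and> \<phi> \<noteq> 0"
  then interpret nonneg_q_equation q \<phi> g
    by unfold_locales auto
  define C where "C = 1 / eval_fps (fps_deriv (q_kernel q \<phi> g)) \<eta>"
  have C: "C > 0" using eval_deriv_U_pos by (simp add: C_def)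
  have "(\<lambda>n. fps_nth g n) \<sim>[at_top] (\<lambda>n. C / \<eta> ^ n)" if "Gcd {n. fps_nth \<phi> n \<noteq> 0} = 1"
  proof (rule asymp_equivI')
    have "(\<lambda>n. fps_nth g n * \<eta> ^ n / C) \<longlonglongrightarrow> C / C"
      using g_limit[OF that] C by (intro tendsto_divide tendsto_const) (auto simp: C_def)
    then show "(\<lambda>n. fps_nth g n / (C / \<eta> ^ n)) \<longlonglongrightarrow> 1"
      using C by simp
  qed
  moreover have "(\<lambda>k. fps_nth \<phi> k * eval_qprod q g \<eta> k) sums 1"
    using sums_eval_U by (simp add: eval_U_eta)
  moreover have "(\<lambda>k. fps_nth \<phi> k * eval_qprod q g \<eta> k * eval_qlogderiv q g \<eta> k) sums (1 / C)"
    using sums_eval_deriv_U by (simp add: C_def)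
  ultimately show "\<exists>\<eta> C :: real. \<eta> > 0 \<and> fps_conv_radius g = ereal \<eta> \<and>
         (\<lambda>k. fps_nth \<phi> k * eval_qprod q g \<eta> k) sums 1 \<and>
         C \<noteq> 0 \<and>
         (\<lambda>k. fps_nth \<phi> k * eval_qprod q g \<eta> k * eval_qlogderiv q g \<eta> k) sums (1 / C) \<and>
         (Gcd {n. fps_nth \<phi> n \<noteq> 0} = 1 \<longrightarrow>
            (\<lambda>n. fps_nth g n) \<sim>[at_top] (\<lambda>n. C / \<eta> ^ n))"
    using eta_pos fps_conv_radius_g C by (intro exI[of _ \<eta>] exI[of _ C]) auto
qed

end
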